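(* Let $G$ be a connected graph on $n\geq 13$ vertices and $m$ edges with minimum degree $\delta\geq 3$. If $$m\geq \binom{n-2}{2}+3,$$ then $G$ is Hamilton-connected unless $G\in \left(\bigcup_{i=0}^{3}\mathcal{S}_{n}^{3}(i)\right)\cup\left(\bigcup_{i=0}^{2}\mathcal{T}_{n}^{3}(i)\right)$, or $n=13$ and $G=S_{13}^{6}$, or $n=14$ and $G\in\bigcup_{i=0}^{1}\mathcal{S}_{14}^{7}(i)$.
   Context: All graphs are finite and simple (no loops or multiple edges); equality of graphs and membership in a family of graphs are up to isomorphism. $\delta=\delta(G)$ is the minimum degree of $G$. A Hamilton path is a path containing all vertices of $G$; $G$ is Hamilton-connected if every two (distinct) vertices of $G$ are connected by a Hamilton path. $G+H$ and $G\vee H$ denote the disjoint union and the join of $G$ and $H$; $kG$ is the disjoint union of $k$ copies of $G$; $K_n$ is the complete graph on $n$ vertices. For $n\geq 5$ and $1\leq k\leq n/2$, define $$S_{n}^{k}=K_{k}\vee (K_{n-(2k-1)}+(k-1)K_{1}),\qquad T_{n}^{k}=K_{2}\vee (K_{n-(k+1)}+K_{k-1}).$$ For $t\geq 1$, $\mathcal{S}_{n}^{k}(t)$ (resp. $\mathcal{T}_{n}^{k}(t)$) denotes the set of all graphs obtained from $S_{n}^{k}$ (resp. $T_{n}^{k}$) by deleting exactly $t$ edges such that the resulting graph has minimum degree at least $3$. Also $\mathcal{S}_{n}^{k}(0)=\{S_{n}^{k}\}$ and $\mathcal{T}_{n}^{k}(0)=\{T_{n}^{k}\}$. *)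

theory Defs
  imports Complex_Main
begin

datatype 'a sgraph = SGraph (verts: "'a set") (edges: "'a set set")

definition simple_graph :: "'a sgraph \<Rightarrow> bool" where
  "simple_graph G \<longleftrightarrow> finite (verts G) \<and> (\<forall>e \<in> edges G. e \<subseteq> verts G \<and> card e = 2)"

definition graph_iso :: "'a sgraph \<Rightarrow> 'b sgraph \<Rightarrow> bool" (infix "\<cong>\<^sub>G" 50) where
  "G \<cong>\<^sub>G H \<longleftrightarrow> (\<exists>f. bij_betw f (verts G) (verts H) \<and>
     (\<forall>u \<in> verts G. \<forall>v \<in> verts G. {u, v} \<in> edges G \<longleftrightarrow> {f u, f v} \<in> edges H))"

definition vdegree :: "'a sgraph \<Rightarrow> 'a \<Rightarrow> nat" where
  "vdegree G v = card {e \<in> edges G. v \<in> e}"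

(* Only meaningful for finite graphs with at least one vertex. *)
definition min_degree :: "'a sgraph \<Rightarrow> nat" where
  "min_degree G = Min (vdegree G ` verts G)"

definition path_in :: "'a sgraph \<Rightarrow> 'a list \<Rightarrow> bool" where
  "path_in G p \<longleftrightarrow> p \<noteq> [] \<and> distinct p \<and> set p \<subseteq> verts G \<and>
     successively (\<lambda>x y. {x, y} \<in> edges G) p"

definition connected_graph :: "'a sgraph \<Rightarrow> bool" where
  "connected_graph G \<longleftrightarrow> verts G \<noteq> {} \<and>
     (\<forall>u \<in> verts G. \<forall>v \<in> verts G. \<exists>p. path_in G p \<and> hd p = u \<and> last p = v)"

definition hamilton_path :: "'a sgraph \<Rightarrow> 'a list \<Rightarrow> bool" where
  "hamilton_path G p \<longleftrightarrow> path_in G p \<and> set p = verts G"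

definition hamilton_connected :: "'a sgraph \<Rightarrow> bool" where
  "hamilton_connected G \<longleftrightarrow>
     (\<forall>u \<in> verts G. \<forall>v \<in> verts G. u \<noteq> v \<longrightarrow>
        (\<exists>p. hamilton_path G p \<and> hd p = u \<and> last p = v))"

definition complete_graph :: "nat \<Rightarrow> nat sgraph" where
  "complete_graph n = SGraph {..<n} {e. e \<subseteq> {..<n} \<and> card e = 2}"

definition graph_union :: "'a sgraph \<Rightarrow> 'b sgraph \<Rightarrow> ('a + 'b) sgraph" where
  "graph_union G H = SGraph (verts G <+> verts H)
     ((`) Inl ` edges G \<union> (`) Inr ` edges H)"

definition graph_join :: "'a sgraph \<Rightarrow> 'b sgraph \<Rightarrow> ('a + 'b) sgraph" where
  "graph_join G H = SGraph (verts G <+> verts H)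
     ((`) Inl ` edges G \<union> (`) Inr ` edges H \<union>
      {{Inl u, Inr v} | u v. u \<in> verts G \<and> v \<in> verts H})"

definition graph_copies :: "nat \<Rightarrow> 'a sgraph \<Rightarrow> (nat \<times> 'a) sgraph" where
  "graph_copies k G = SGraph ({..<k} \<times> verts G) (\<Union>i<k. (`) (Pair i) ` edges G)"

(* S_graph n k and T_graph n k are intended for n \<ge> 5 and 1 \<le> k \<le> n/2; in that range
   none of the subtractions below truncates. *)
definition S_graph :: "nat \<Rightarrow> nat \<Rightarrow> (nat + nat + nat \<times> nat) sgraph" where
  "S_graph n k = graph_join (complete_graph k)
     (graph_union (complete_graph (n - (2 * k - 1))) (graph_copies (k - 1) (complete_graph 1)))"

definition T_graph :: "nat \<Rightarrow> nat \<Rightarrow> (nat + nat + nat) sgraph" where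
  "T_graph n k = graph_join (complete_graph 2)
     (graph_union (complete_graph (n - (k + 1))) (complete_graph (k - 1)))"

definition delete_edges :: "'a sgraph \<Rightarrow> 'a set set \<Rightarrow> 'a sgraph" where
  "delete_edges G D = SGraph (verts G) (edges G - D)"

(* The families are closed under isomorphism, with members over an arbitrary vertex type 'b,
   so that membership up to isomorphism is plain set membership. For t = 0 the family is just
   the (isomorphism class of the) graph itself, with no minimum degree condition. *)
definition edge_deleted_family :: "'a sgraph \<Rightarrow> nat \<Rightarrow> 'b sgraph set" where
  "edge_deleted_family G t = {H. simple_graph H \<and>
     (if t = 0 then H \<cong>\<^sub>G G
      else \<exists>D \<subseteq> edges G. card D = t \<and> min_degree (delete_edges G D) \<ge> 3 \<and>
             H \<cong>\<^sub>G delete_edges G D)}"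

definition S_family :: "nat \<Rightarrow> nat \<Rightarrow> nat \<Rightarrow> 'b sgraph set" where
  "S_family n k t = edge_deleted_family (S_graph n k) t"

definition T_family :: "nat \<Rightarrow> nat \<Rightarrow> nat \<Rightarrow> 'b sgraph set" where
  "T_family n k t = edge_deleted_family (T_graph n k) t"

end

theory Submission
  imports Defs
begin

text \<open>
  The proof passes to an edge-maximal supergraph \<open>H\<close> of \<open>G\<close> on the same vertices that is not
  Hamilton-connected. A Bondy--Chvatal rotation (\<open>reroute_hamilton_path\<close>) shows that joining two
  vertices with degree sum at least \<open>n + 1\<close> does not affect Hamilton-connectedness, so in \<open>H\<close>
  nonadjacent vertices have degree sum at most \<open>n\<close>. A nonadjacent pair with the largest degree
  sum then exhibits, for some \<open>k \<le> n / 2\<close> that is a vertex degree and hence at least 3, a set of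
  \<open>k - 1\<close> vertices of degree at most \<open>k\<close> (\<open>low_degree_sets\<close>). Consequently \<open>H\<close> has at most
  \<open>((n - k + 1) choose 2) + (k - 1) * k\<close> edges, the number of edges of \<open>S_graph n k\<close>.

  This bound is convex in \<open>k\<close>, and comparing it with \<open>((n - 2) choose 2) + 3\<close> leaves only
  \<open>k = 3\<close>, \<open>(n, k) = (13, 6)\<close> and \<open>(n, k) = (14, 7)\<close> (\<open>exceptional_parameters\<close>). In each case the
  edge number is so close to the maximum that closedness of \<open>H\<close> forces the low vertices to attach
  to a common small set (\<open>low_pair_structure\<close>, \<open>extremal_structure\<close>, \<open>low_half_independent\<close>).
  Every subgraph of \<open>H\<close> inherits this, so \<open>G\<close> itself embeds into the corresponding
  \<open>S_graph\<close> or \<open>T_graph\<close>, and comparing the numbers of edges bounds how many were deleted.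
\<close>

section \<open>Neighbourhoods and degrees\<close>

definition neighbours :: "'a sgraph \<Rightarrow> 'a \<Rightarrow> 'a set" where
  "neighbours G v = {w. {v, w} \<in> edges G}"

lemma simple_graph_edgeD:
  assumes "simple_graph G" "{u, v} \<in> edges G"
  shows "u \<in> verts G" "v \<in> verts G" "u \<noteq> v"
proof -
  have "{u, v} \<subseteq> verts G" "card {u, v} = 2" using assms unfolding simple_graph_def by blast+
  then show "u \<in> verts G" "v \<in> verts G" "u \<noteq> v" by auto
qed

lemma neighbours_subset:
  assumes "simple_graph G"
  shows "neighbours G v \<subseteq> verts G - {v}"
proof
  fix w assume "w \<in> neighbours G v"
  then have "{v, w} \<in> edges G" by (simp add: neighbours_def)
  from simple_graph_edgeD[OF assms this] show "w \<in> verts G - {v}" by simp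
qed

lemma finite_neighbours:
  assumes "simple_graph G"
  shows "finite (neighbours G v)"
  using assms finite_subset[OF neighbours_subset[OF assms]] unfolding simple_graph_def by simp

lemma neighbours_sym: "w \<in> neighbours G v \<longleftrightarrow> v \<in> neighbours G w"
  unfolding neighbours_def by (simp add: insert_commute)

lemma finite_edges:
  assumes "simple_graph G"
  shows "finite (edges G)"
proof -
  have "edges G \<subseteq> Pow (verts G)" using assms unfolding simple_graph_def by blast
  moreover have "finite (Pow (verts G))" using assms unfolding simple_graph_def by simp
  ultimately show ?thesis by (rule finite_subset)
qed

lemma vdegree_eq_card_neighbours:
  assumes "simple_graph G"
  shows "vdegree G v = card (neighbours G v)"
proof -
  have "bij_betw (\<lambda>w. {v, w}) (neighbours G v) {e \<in> edges G. v \<in> e}"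
  proof (rule bij_betwI')
    fix x y assume "x \<in> neighbours G v" "y \<in> neighbours G v"
    show "({v, x} = {v, y}) = (x = y)" by (auto simp: doubleton_eq_iff)
  next
    fix x assume "x \<in> neighbours G v"
    then show "{v, x} \<in> {e \<in> edges G. v \<in> e}" by (simp add: neighbours_def)
  next
    fix e assume e: "e \<in> {e \<in> edges G. v \<in> e}"
    then have "card e = 2" using assms unfolding simple_graph_def by blast
    then obtain a b where ab: "e = {a, b}" by (meson card_2_iff)
    then have "e = {v, a} \<or> e = {v, b}" using e by auto
    then show "\<exists>x\<in>neighbours G v. e = {v, x}"
      using e unfolding neighbours_def by blast
  qed
  then show ?thesis unfolding vdegree_def by (simp add: bij_betw_same_card)
qed

section \<open>The closure for Hamilton-connectedness\<close>

lemma not_successivelyE: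
  assumes "\<not> successively P p"
  obtains xs a b ys where "p = xs @ a # b # ys" "\<not> P a b"
proof -
  have "\<exists>xs a b ys. p = xs @ a # b # ys \<and> \<not> P a b"
    using assms
  proof (induction p)
    case Nil
    then show ?case by simp
  next
    case (Cons c p)
    show ?case
    proof (cases "successively P p")
      case True
      then obtain d q where "p = d # q" "\<not> P c d" using Cons.prems
        by (cases p) auto
      then have "c # p = [] @ c # d # q" by simp
      then show ?thesis using \<open>\<not> P c d\<close> by blast
    next
      case False
      then obtain xs a b ys where "p = xs @ a # b # ys" "\<not> P a b" using Cons.IH by blast
      then have "c # p = (c # xs) @ a # b # ys" by simp
      then show ?thesis using \<open>\<not> P a b\<close> by blast
    qed
  qed
  then show ?thesis using that by blast
qed

text \<open>
  Charge the membership of a list element in \<open>B\<close> to its predecessor: every adjacent pair then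
  carries at most one membership, and only the two ends of the list escape this charge.
\<close>

lemma non_crossing_length_bound:
  assumes "successively (\<lambda>a b. \<not> (a \<in> A \<and> b \<in> B)) p" "p \<noteq> []"
  shows "length (filter (\<lambda>x. x \<in> A) p) + length (filter (\<lambda>x. x \<in> B) p)
     < length p + of_bool (last p \<in> A) + of_bool (hd p \<in> B)"
  using assms
proof (induction "(\<lambda>a b. \<not> (a \<in> A \<and> b \<in> B))" p rule: successively.induct)
  case 1
  then show ?case by simp
next
  case (2 c)
  show ?case by simp
next
  case (3 c d q)
  let ?f = "\<lambda>X l. length (filter (\<lambda>x. x \<in> X) l)"
  have IH: "?f A (d # q) + ?f B (d # q) < length (d # q) + of_bool (last (d # q) \<in> A) + of_bool (d \<in> B)"
    using 3 by simp
  have c: "of_bool (c \<in> A) + of_bool (d \<in> B) \<le> (1 :: nat)"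
    using 3 by (simp del: filter.simps)
  have f: "?f X (c # d # q) = of_bool (c \<in> X) + ?f X (d # q)" for X by simp
  have l: "last (c # d # q) = last (d # q)" "length (c # d # q) = 1 + length (d # q)" by simp_all
  show ?case unfolding f l list.sel using IH c by linarith
qed

lemma successively_append3:
  assumes "successively R p" "successively R q" "successively R r" "p \<noteq> []" "q \<noteq> []" "r \<noteq> []"
    and "R (last p) (hd q)" "R (last q) (hd r)"
  shows "successively R (p @ q @ r)"
  using assms by (simp add: successively_append_iff hd_append)

text \<open>
  The rotation argument behind the Bondy--Chvatal closure, for Hamilton paths with prescribed
  ends. The two paths together cover all vertices and are joined by the pair \<open>u, v\<close>, a
  possibly missing edge. If one of them has consecutive vertices \<open>a, b\<close> with \<open>a\<close> adjacent to \<open>u\<close> and \<open>b\<close>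
  adjacent to \<open>v\<close>, reversing the segment between this pair and the junction gives a Hamilton path
  with the same ends. If neither of them does, the preceding bound applied to both paths makes the
  degree sum of \<open>u\<close> and \<open>v\<close> at most the number of vertices.
\<close>

lemma reroute_hamilton_path:
  assumes G: "simple_graph G"
    and deg: "vdegree G u + vdegree G v > card (verts G)"
    and dist: "distinct (xs @ u # v # ys)" and set: "set (xs @ u # v # ys) = verts G"
    and sP: "successively (\<lambda>x y. {x, y} \<in> edges G) (xs @ [u])"
    and sQ: "successively (\<lambda>x y. {x, y} \<in> edges G) (v # ys)"
  shows "\<exists>q. hamilton_path G q \<and> hd q = hd (xs @ [u]) \<and> last q = last (v # ys)"
proof (rule ccontr)
  let ?S = "successively (\<lambda>x y. {x, y} \<in> edges G)"
  have symS: "?S (rev l) = ?S l" for l by (simp add: insert_commute)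
  assume none: "\<not> ?thesis"
  define N where "N = neighbours G"
  let ?nc = "successively (\<lambda>a b. \<not> (a \<in> N u \<and> b \<in> N v))"
  \<comment> \<open>Such a pair in the first path: reverse the segment after \<open>a\<close>, which ends in \<open>u\<close>.\<close>
  have P: "?nc (xs @ [u])"
  proof (rule ccontr)
    assume "\<not> ?thesis"
    then obtain P1 a b P2 where eq: "xs @ [u] = P1 @ a # b # P2" and ab: "a \<in> N u" "b \<in> N v"
      by (rule not_successivelyE) auto
    define q where "q = (P1 @ [a]) @ rev (b # P2) @ (v # ys)"
    have lu: "last (b # P2) = u" using arg_cong[OF eq, of last] by simp
    have s1: "?S (P1 @ [a])" and s2: "?S (b # P2)"
      using sP unfolding eq by (auto simp: successively_append_iff successively_Cons)
    have "hd (rev (b # P2)) = u" using lu by (metis hd_rev)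
    moreover have "last (rev (b # P2)) = b" by simp
    moreover have "{a, u} \<in> edges G" "{b, v} \<in> edges G"
      using ab unfolding N_def neighbours_def by (auto simp: insert_commute)
    moreover have "?S (rev (b # P2))" using s2 symS by blast
    ultimately have q: "?S q" using s1 sQ unfolding q_def
      by (intro successively_append3) (simp_all del: rev.simps)
    have whole: "xs @ u # v # ys = (P1 @ a # b # P2) @ v # ys" using eq by simp
    have q1: "distinct q" "set q = verts G"
      using dist set unfolding whole q_def by auto
    have q2: "hd q = hd (xs @ [u])" unfolding eq q_def by (simp add: hd_append)
    have q3: "last q = last (v # ys)" unfolding q_def by simp
    have "q \<noteq> []" unfolding q_def by simp
    then have "hamilton_path G q" using q q1 unfolding hamilton_path_def path_in_def by blast
    then show False using none q2 q3 by blast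
  qed
  \<comment> \<open>Such a pair in the second path: reverse the segment up to \<open>a\<close>, which starts with \<open>v\<close>.\<close>
  have Q: "?nc (v # ys)"
  proof (rule ccontr)
    assume "\<not> ?thesis"
    then obtain Q1 a b Q2 where eq: "v # ys = Q1 @ a # b # Q2" and ab: "a \<in> N u" "b \<in> N v"
      by (rule not_successivelyE) auto
    define q where "q = (xs @ [u]) @ rev (Q1 @ [a]) @ (b # Q2)"
    have hv: "hd (Q1 @ [a]) = v" using arg_cong[OF eq, of hd] by (simp add: hd_append split: if_splits)
    have s1: "?S (Q1 @ [a])" and s2: "?S (b # Q2)"
      using sQ unfolding eq by (auto simp: successively_append_iff successively_Cons)
    have "last (rev (Q1 @ [a])) = v" using hv by (metis last_rev)
    moreover have "hd (rev (Q1 @ [a])) = a" by simp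
    moreover have "{u, a} \<in> edges G" "{v, b} \<in> edges G"
      using ab unfolding N_def neighbours_def by auto
    moreover have "?S (rev (Q1 @ [a]))" using s1 symS by blast
    ultimately have q: "?S q" using s2 sP unfolding q_def
      by (intro successively_append3) (simp_all del: rev.simps)
    have whole: "xs @ u # v # ys = (xs @ [u]) @ Q1 @ a # b # Q2" using eq by simp
    have q1: "distinct q" "set q = verts G"
      using dist set unfolding whole q_def by auto
    have q2: "hd q = hd (xs @ [u])" unfolding q_def by (simp add: hd_append)
    have q3: "last q = last (v # ys)" unfolding eq q_def by simp
    have "q \<noteq> []" unfolding q_def by simp
    then have "hamilton_path G q" using q q1 unfolding hamilton_path_def path_in_def by blast
    then show False using none q2 q3 by blast
  qed
  have cnt: "length (filter (\<lambda>x. x \<in> N w) (xs @ [u])) + length (filter (\<lambda>x. x \<in> N w) (v # ys))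
      = vdegree G w" for w
  proof -
    have "length (filter (\<lambda>x. x \<in> N w) (xs @ [u])) + length (filter (\<lambda>x. x \<in> N w) (v # ys))
      = length (filter (\<lambda>x. x \<in> N w) (xs @ u # v # ys))" by simp
    also have "\<dots> = card (set (filter (\<lambda>x. x \<in> N w) (xs @ u # v # ys)))"
      using dist by (metis distinct_card distinct_filter)
    also have "set (filter (\<lambda>x. x \<in> N w) (xs @ u # v # ys)) = N w"
      using set neighbours_subset[OF G, of w] unfolding set_filter N_def by blast
    finally show ?thesis by (simp add: N_def vdegree_eq_card_neighbours[OF G])
  qed
  \<comment> \<open>No loops: at the junction neither path gets the extra unit that the bound allows
    at the ends.\<close>
  have "of_bool (last (xs @ [u]) \<in> N u) = (0 :: nat)" "of_bool (hd (v # ys) \<in> N v) = (0 :: nat)"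
    using neighbours_subset[OF G] unfolding N_def by auto
  moreover have "of_bool b \<le> (1 :: nat)" for b by simp
  note this[of "hd (xs @ [u]) \<in> N v"] this[of "last (v # ys) \<in> N u"]
  moreover have "xs @ [u] \<noteq> []" "v # ys \<noteq> []" by simp_all
  note non_crossing_length_bound[OF P this(1)] non_crossing_length_bound[OF Q this(2)]
  ultimately have "vdegree G u + vdegree G v \<le> length (xs @ [u]) + length (v # ys)"
    using cnt[of u] cnt[of v] by linarith
  also have "\<dots> = card (verts G)" using distinct_card[OF dist] set by simp
  finally show False using deg by simp
qed

text \<open>
  A Hamilton path uses the added edge at most once, because its vertices are distinct; so either
  it already lies in \<open>G\<close>, or removing that edge leaves two paths that can be rerouted.
\<close>

lemma hamilton_connected_if_add_edge:
  assumes G: "simple_graph G"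
    and deg: "vdegree G u + vdegree G v > card (verts G)"
    and hc: "hamilton_connected (SGraph (verts G) (insert {u, v} (edges G)))"
  shows "hamilton_connected G"
  unfolding hamilton_connected_def
proof (intro ballI impI)
  fix x y assume "x \<in> verts G" "y \<in> verts G" "x \<noteq> y"
  then obtain p where p: "p \<noteq> []" "distinct p" "set p = verts G" "hd p = x" "last p = y"
    and sp: "successively (\<lambda>a b. {a, b} \<in> insert {u, v} (edges G)) p"
    using hc unfolding hamilton_connected_def hamilton_path_def path_in_def by auto
  show "\<exists>p. hamilton_path G p \<and> hd p = x \<and> last p = y"
  proof (cases "successively (\<lambda>a b. {a, b} \<in> edges G) p")
    case True
    then show ?thesis using p unfolding hamilton_path_def path_in_def by blast
  next
    case False
    then obtain xs a b ys where eq: "p = xs @ a # b # ys" and ab: "{a, b} \<notin> edges G"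
      by (rule not_successivelyE)
    have "{a, b} \<in> insert {u, v} (edges G)"
      using sp unfolding eq by (simp add: successively_append_iff)
    then have uv: "{a, b} = {u, v}" using ab by blast
    \<comment> \<open>Each half omits one end of the added edge, so it cannot use that edge.\<close>
    have keep: "successively (\<lambda>a b. {a, b} \<in> edges G) l"
      if "successively (\<lambda>a b. {a, b} \<in> insert {u, v} (edges G)) l" "\<not> {u, v} \<subseteq> set l" for l
    proof (rule successively_mono[OF that(1)])
      fix c d assume "c \<in> set l" "d \<in> set l" "{c, d} \<in> insert {u, v} (edges G)"
      then show "{c, d} \<in> edges G" using that(2) by auto
    qed
    have "successively (\<lambda>a b. {a, b} \<in> edges G) (xs @ [a])"
      using sp p(2) unfolding eq uv[symmetric]
      by (intro keep[unfolded uv[symmetric]]) (auto simp: successively_append_iff)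
    moreover have "successively (\<lambda>a b. {a, b} \<in> edges G) (b # ys)"
      using sp p(2) unfolding eq uv[symmetric]
      by (intro keep[unfolded uv[symmetric]]) (auto simp: successively_append_iff)
    moreover have "vdegree G a + vdegree G b > card (verts G)"
      using uv deg by (auto simp: doubleton_eq_iff)
    ultimately obtain q where "hamilton_path G q" "hd q = hd (xs @ [a])" "last q = last (b # ys)"
      using reroute_hamilton_path[OF G, of a b xs ys] p(2,3) unfolding eq by blast
    moreover have "hd (xs @ [a]) = hd p" "last (b # ys) = last p"
      unfolding eq by (simp_all add: hd_append)
    ultimately show ?thesis using p(4,5) by metis
  qed
qed

lemma successively_if_complete:
  assumes "\<And>a b. a \<in> V \<Longrightarrow> b \<in> V \<Longrightarrow> a \<noteq> b \<Longrightarrow> R a b" "set l \<subseteq> V" "distinct l"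
  shows "successively R l"
  using assms(2,3)
proof (induction l)
  case Nil
  then show ?case by simp
next
  case (Cons c l)
  then show ?case using assms(1) by (cases l) auto
qed

lemma hamilton_connected_if_complete:
  assumes fin: "finite (verts G)"
    and complete: "\<And>u v. u \<in> verts G \<Longrightarrow> v \<in> verts G \<Longrightarrow> u \<noteq> v \<Longrightarrow> {u, v} \<in> edges G"
  shows "hamilton_connected G"
  unfolding hamilton_connected_def
proof (intro ballI impI)
  fix u v assume uv: "u \<in> verts G" "v \<in> verts G" "u \<noteq> v"
  obtain l where l: "set l = verts G - {u, v}" "distinct l"
    using finite_distinct_list[of "verts G - {u, v}"] fin by auto
  let ?p = "u # l @ [v]"
  have p: "distinct ?p" "set ?p = verts G" using l uv by auto
  then have "successively (\<lambda>a b. {a, b} \<in> edges G) ?p"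
    using complete by (intro successively_if_complete[of "verts G"]) auto
  then have "hamilton_path G ?p" using p unfolding hamilton_path_def path_in_def by simp
  then show "\<exists>p. hamilton_path G p \<and> hd p = u \<and> last p = v"
    by (intro exI[of _ ?p]) simp
qed

text \<open>
  The graphs that are their own Bondy--Chvatal closure for Hamilton-connectedness.
\<close>

definition degree_sum_closed :: "'a sgraph \<Rightarrow> bool" where
  "degree_sum_closed H \<longleftrightarrow> (\<forall>u \<in> verts H. \<forall>v \<in> verts H. u \<noteq> v \<longrightarrow> {u, v} \<notin> edges H \<longrightarrow>
     vdegree H u + vdegree H v \<le> card (verts H))"

lemma degree_sum_closedD:
  assumes "degree_sum_closed H" "u \<in> verts H" "v \<in> verts H" "u \<noteq> v" "{u, v} \<notin> edges H"
  shows "vdegree H u + vdegree H v \<le> card (verts H)"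
  using assms unfolding degree_sum_closed_def by blast

text \<open>
  Instead of iterating the closure operation, take an edge-maximal supergraph that is still not
  Hamilton-connected: adding any edge makes it Hamilton-connected, so by the closure lemma
  no missing edge can have a large degree sum.
\<close>

lemma maximal_non_hamilton_connected:
  assumes G: "simple_graph G" and nhc: "\<not> hamilton_connected G"
  obtains H where "simple_graph H" "verts H = verts G" "edges G \<subseteq> edges H"
    "\<not> hamilton_connected H"
    "degree_sum_closed H"
proof -
  let ?V = "verts G"
  define F where "F = {E. edges G \<subseteq> E \<and> E \<subseteq> {e. e \<subseteq> ?V \<and> card e = 2}
    \<and> \<not> hamilton_connected (SGraph ?V E)}"
  have "F \<subseteq> Pow (Pow ?V)" unfolding F_def by blast
  moreover have "finite (Pow (Pow ?V))" using G unfolding simple_graph_def by simp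
  ultimately have "finite F" by (rule finite_subset)
  moreover have "edges G \<in> F" using G nhc unfolding F_def simple_graph_def by auto
  ultimately obtain E where E: "E \<in> F" and max: "\<And>E'. E' \<in> F \<Longrightarrow> E \<subseteq> E' \<Longrightarrow> E = E'"
    by (metis finite_has_maximal2)
  let ?H = "SGraph ?V E"
  have H: "simple_graph ?H" using E G unfolding F_def simple_graph_def by auto
  show thesis
  proof (rule that[of ?H])
    show "simple_graph ?H" by fact
    show "verts ?H = ?V" "edges G \<subseteq> edges ?H" "\<not> hamilton_connected ?H"
      using E unfolding F_def by simp_all
    show "degree_sum_closed ?H"
      unfolding degree_sum_closed_def
    proof (intro ballI impI)
      fix u v assume uv: "u \<in> verts ?H" "v \<in> verts ?H" "u \<noteq> v" "{u, v} \<notin> edges ?H"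
      have "insert {u, v} E \<notin> F" using max[of "insert {u, v} E"] uv(4) by auto
      then have "hamilton_connected (SGraph (verts ?H) (insert {u, v} (edges ?H)))"
        using E uv(1-3) unfolding F_def by auto
      then show "vdegree ?H u + vdegree ?H v \<le> card (verts ?H)"
        using hamilton_connected_if_add_edge[OF H, of u v] \<open>\<not> hamilton_connected ?H\<close> by linarith
    qed
  qed
qed

text \<open>
  Such a graph is not complete. Among the nonadjacent pairs choose \<open>u, v\<close> with maximal degree sum
  and \<open>d(u) \<le> d(v)\<close>. By maximality every non-neighbour of \<open>v\<close> has degree at most \<open>d(u)\<close>, and every
  non-neighbour of \<open>u\<close> has degree at most \<open>d(v) \<le> n - d(u)\<close>; counting these non-neighbours gives
  \<open>A\<close> and \<open>U\<close>, with \<open>u\<close> as the vertex \<open>x\<close>. This is Berge's degree sequence condition.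
\<close>

lemma low_degree_sets:
  assumes H: "simple_graph H" and nhc: "\<not> hamilton_connected H"
    and closed: "degree_sum_closed H"
  obtains x A U where "x \<in> verts H" "2 * vdegree H x \<le> card (verts H)"
    "A \<subseteq> verts H" "card A = vdegree H x - 1" "\<And>a. a \<in> A \<Longrightarrow> vdegree H a \<le> vdegree H x"
    "U \<subseteq> verts H" "card U = card (verts H) - vdegree H x"
    "\<And>w. w \<in> U \<Longrightarrow> vdegree H w \<le> card (verts H) - vdegree H x"
proof -
  let ?V = "verts H" and ?d = "vdegree H" and ?n = "card (verts H)"
  have fin: "finite ?V" using H unfolding simple_graph_def by blast
  define P where "P = {(u, v). u \<in> ?V \<and> v \<in> ?V \<and> u \<noteq> v \<and> {u, v} \<notin> edges H}"
  let ?s = "\<lambda>(u, v). ?d u + ?d v"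
  have "P \<subseteq> ?V \<times> ?V" unfolding P_def by blast
  moreover have "finite (?V \<times> ?V)" using fin by simp
  ultimately have "finite P" by (rule finite_subset)
  moreover have "P \<noteq> {}" using hamilton_connected_if_complete[OF fin] nhc unfolding P_def by blast
  ultimately obtain a b where ab: "(a, b) \<in> P" and ab_max: "\<And>q. q \<in> P \<Longrightarrow> ?s q \<le> ?s (a, b)"
    using finite_imageI[of P ?s] Max_ge[of "?s ` P"] Max_in[of "?s ` P"]
    by (smt (verit) image_iff imageI image_is_empty surj_pair)
  obtain u v where uv: "(u, v) \<in> P" and le: "?d u \<le> ?d v" and max: "\<And>q. q \<in> P \<Longrightarrow> ?s q \<le> ?d u + ?d v"
  proof (cases "?d a \<le> ?d b")
    case True
    then show ?thesis using that[of a b] ab ab_max by simp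
  next
    case False
    moreover have "(b, a) \<in> P" using ab unfolding P_def by (auto simp: insert_commute)
    ultimately show ?thesis using that[of b a] ab_max by (simp add: add.commute)
  qed
  let ?N = "neighbours H"
  have sum: "?d u + ?d v \<le> ?n" using degree_sum_closedD[OF closed, of u v] uv unfolding P_def by blast
  have uV: "u \<in> ?V" and vV: "v \<in> ?V" using uv unfolding P_def by auto
  have sub: "?N w \<subseteq> ?V - {w}" for w using neighbours_subset[OF H] .
  have "card (?V - {v} - ?N v) = ?n - 1 - ?d v"
    using fin vV sub[of v] by (simp add: card_Diff_subset finite_neighbours[OF H] vdegree_eq_card_neighbours[OF H])
  then have "?d u - 1 \<le> card (?V - {v} - ?N v)" using sum by linarith
  then obtain A where A: "A \<subseteq> ?V - {v} - ?N v" "card A = ?d u - 1"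
    by (meson obtain_subset_with_card_n)
  have dA: "?d w \<le> ?d u" if "w \<in> A" for w
  proof -
    have "(w, v) \<in> P" using that A(1) vV unfolding P_def neighbours_def by (auto simp: insert_commute)
    then show ?thesis using max by fastforce
  qed
  let ?U = "?V - ?N u"
  have cU: "card ?U = ?n - ?d u"
    using fin sub[of u] by (subst card_Diff_subset) (auto simp: finite_neighbours[OF H] vdegree_eq_card_neighbours[OF H])
  have dU: "?d w \<le> ?n - ?d u" if "w \<in> ?U" for w
  proof (cases "w = u")
    case True
    then show ?thesis using le sum by simp
  next
    case False
    then have "(u, w) \<in> P" using that uV unfolding P_def neighbours_def by auto
    then have "?d u + ?d w \<le> ?d u + ?d v" using max by fastforce
    then show ?thesis using sum by linarith
  qed
  show thesis
    using A dA cU dU le sum by (intro that[of u A ?U] uV) auto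
qed

section \<open>Counting edges by degrees\<close>

text \<open>
  Summing degrees over \<open>A\<close> counts an edge once for each endpoint in \<open>A\<close>. Keeping the number of
  edges inside \<open>A\<close> as an explicit term is what makes the equality case usable later.
\<close>

lemma edge_count_by_degrees:
  assumes G: "simple_graph G" and A: "finite A"
  shows "card (edges G) + card {e \<in> edges G. e \<subseteq> A}
    = card {e \<in> edges G. e \<inter> A = {}} + (\<Sum>a\<in>A. vdegree G a)"
proof -
  let ?E = "edges G"
  have fin: "finite ?E" using finite_edges[OF G] .
  have "(\<Sum>a\<in>A. vdegree G a) = (\<Sum>a\<in>A. \<Sum>e\<in>?E. of_bool (a \<in> e))"
    unfolding vdegree_def using fin by (simp add: sum.If_cases of_bool_def Int_def)
  also have "\<dots> = (\<Sum>e\<in>?E. \<Sum>a\<in>A. of_bool (a \<in> e))" by (rule sum.swap)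
  also have "\<dots> = (\<Sum>e\<in>?E. card (A \<inter> e))"
    using A by (simp add: sum.If_cases of_bool_def Int_def)
  finally have deg: "(\<Sum>a\<in>A. vdegree G a) = (\<Sum>e\<in>?E. card (A \<inter> e))" .
  have each: "1 + of_bool (e \<subseteq> A) = of_bool (e \<inter> A = {}) + card (A \<inter> e)" if "e \<in> ?E" for e
  proof -
    have "card e = 2" using that G unfolding simple_graph_def by blast
    then obtain a b where "e = {a, b}" "a \<noteq> b" by (meson card_2_iff)
    then show ?thesis by (cases "a \<in> A"; cases "b \<in> A") simp_all
  qed
  have cnt: "card {e \<in> ?E. Q e} = (\<Sum>e\<in>?E. of_bool (Q e))" for Q
    using fin by (simp add: sum.If_cases of_bool_def Int_def)
  have "card ?E + card {e \<in> ?E. e \<subseteq> A} = (\<Sum>e\<in>?E. 1 + of_bool (e \<subseteq> A))"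
    unfolding cnt by (simp only: sum.distrib card_eq_sum)
  also have "\<dots> = (\<Sum>e\<in>?E. of_bool (e \<inter> A = {}) + card (A \<inter> e))"
    using each by (intro sum.cong) auto
  also have "\<dots> = card {e \<in> ?E. e \<inter> A = {}} + (\<Sum>a\<in>A. vdegree G a)"
    unfolding cnt deg by (simp add: sum.distrib)
  finally show ?thesis .
qed

lemma edges_avoiding_le_choose:
  assumes G: "simple_graph G" and A: "A \<subseteq> verts G"
  shows "card {e \<in> edges G. e \<inter> A = {}} \<le> (card (verts G) - card A) choose 2"
    and "card {e \<in> edges G. e \<inter> A = {}} = (card (verts G) - card A) choose 2 \<Longrightarrow>
      x \<in> verts G - A \<Longrightarrow> y \<in> verts G - A \<Longrightarrow> x \<noteq> y \<Longrightarrow> {x, y} \<in> edges G"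
proof -
  have fin: "finite (verts G)" using G unfolding simple_graph_def by blast
  let ?K = "{e. e \<subseteq> verts G - A \<and> card e = 2}"
  have "card (verts G - A) = card (verts G) - card A"
    using A fin by (simp add: card_Diff_subset finite_subset)
  then have K: "card ?K = (card (verts G) - card A) choose 2"
    using n_subsets[of "verts G - A" 2] fin by simp
  have sub: "{e \<in> edges G. e \<inter> A = {}} \<subseteq> ?K" using G unfolding simple_graph_def by blast
  have "finite ?K" using fin by simp
  then show "card {e \<in> edges G. e \<inter> A = {}} \<le> (card (verts G) - card A) choose 2"
    using card_mono[OF _ sub] K by simp
  assume "card {e \<in> edges G. e \<inter> A = {}} = (card (verts G) - card A) choose 2"
    and xy: "x \<in> verts G - A" "y \<in> verts G - A" "x \<noteq> y"
  then have "{e \<in> edges G. e \<inter> A = {}} = ?K" using card_subset_eq[OF \<open>finite ?K\<close> sub] K by simp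
  moreover have "{x, y} \<in> ?K" using xy by simp
  ultimately show "{x, y} \<in> edges G" by blast
qed

lemma edges_avoiding_eq_choose:
  assumes G: "simple_graph G" and A: "A \<subseteq> verts G"
    and complete: "\<And>x y. x \<in> verts G - A \<Longrightarrow> y \<in> verts G - A \<Longrightarrow> x \<noteq> y \<Longrightarrow> {x, y} \<in> edges G"
  shows "card {e \<in> edges G. e \<inter> A = {}} = (card (verts G) - card A) choose 2"
proof -
  have fin: "finite (verts G)" using G unfolding simple_graph_def by blast
  have "{e \<in> edges G. e \<inter> A = {}} = {e. e \<subseteq> verts G - A \<and> card e = 2}"
  proof
    show "{e \<in> edges G. e \<inter> A = {}} \<subseteq> {e. e \<subseteq> verts G - A \<and> card e = 2}"
      using G unfolding simple_graph_def by blast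
    show "{e. e \<subseteq> verts G - A \<and> card e = 2} \<subseteq> {e \<in> edges G. e \<inter> A = {}}"
    proof
      fix e assume "e \<in> {e. e \<subseteq> verts G - A \<and> card e = 2}"
      then have e: "e \<subseteq> verts G - A" "card e = 2" by simp_all
      then obtain a b where ab: "e = {a, b}" "a \<noteq> b" by (meson card_2_iff)
      then have "{a, b} \<in> edges G" using e(1) by (intro complete) simp_all
      then show "e \<in> {e \<in> edges G. e \<inter> A = {}}" using e(1) ab(1) by blast
    qed
  qed
  moreover have "card (verts G - A) = card (verts G) - card A"
    using finite_subset[OF A fin] A by (rule card_Diff_subset)
  ultimately show ?thesis using n_subsets[of "verts G - A" 2] fin by simp
qed

lemma edge_count_upper_bound:
  assumes "simple_graph G" "A \<subseteq> verts G"
  shows "card (edges G) + card {e \<in> edges G. e \<subseteq> A}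
    \<le> ((card (verts G) - card A) choose 2) + (\<Sum>a\<in>A. vdegree G a)"
proof -
  have "finite A" using assms finite_subset unfolding simple_graph_def by metis
  from edge_count_by_degrees[OF assms(1) this] edges_avoiding_le_choose(1)[OF assms]
  show ?thesis by simp
qed

section \<open>The extremal graphs and their edge-deleted families\<close>

text \<open>
  Membership in a family of edge-deleted subgraphs reduces to a bijective homomorphism: the deleted
  edges are those outside the image of \<open>G\<close>, and their number is determined by the edge counts. The
  minimum degree demanded of the deleted graph is inherited through the isomorphism.
\<close>

lemma edge_deleted_family_if_embedding:
  assumes G: "simple_graph G" and K: "simple_graph K"
    and f: "bij_betw f (verts G) (verts K)"
    and hom: "\<And>u v. {u, v} \<in> edges G \<Longrightarrow> {f u, f v} \<in> edges K"
    and deg: "min_degree G \<ge> 3"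
  shows "card (edges G) \<le> card (edges K)"
    and "G \<in> edge_deleted_family K (card (edges K) - card (edges G))"
proof -
  have inj: "inj_on f (verts G)" using f by (rule bij_betw_imp_inj_on)
  define F where "F = (`) f ` edges G"
  have "edges G \<subseteq> Pow (verts G)" using G unfolding simple_graph_def by blast
  then have "inj_on ((`) f) (edges G)" by (rule inj_on_subset[OF inj_on_image_Pow[OF inj]])
  then have cF: "card F = card (edges G)" unfolding F_def by (rule card_image)
  have FK: "F \<subseteq> edges K"
  proof
    fix e assume "e \<in> F"
    then obtain d where d: "d \<in> edges G" "e = f ` d" unfolding F_def by blast
    then have "card d = 2" using G unfolding simple_graph_def by blast
    then obtain u v where "d = {u, v}" by (meson card_2_iff)
    then show "e \<in> edges K" using d hom by simp
  qed
  have finK: "finite (edges K)" using finite_edges[OF K] .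
  show "card (edges G) \<le> card (edges K)" using card_mono[OF finK FK] cF by simp
  let ?t = "card (edges K) - card (edges G)"
  define D where "D = edges K - F"
  have D: "D \<subseteq> edges K" "edges K - D = F" using FK unfolding D_def by blast+
  have cD: "card D = ?t"
    using cF card_Diff_subset[OF finite_subset[OF FK finK] FK] unfolding D_def by simp
  let ?H = "delete_edges K D"
  have H: "verts ?H = verts K" "edges ?H = F" using D unfolding delete_edges_def by simp_all
  have iff: "{u, v} \<in> edges G \<longleftrightarrow> {f u, f v} \<in> F" if uv: "u \<in> verts G" "v \<in> verts G" for u v
  proof
    assume "{u, v} \<in> edges G"
    then show "{f u, f v} \<in> F" unfolding F_def by (intro image_eqI[of _ _ "{u, v}"]) simp_all
  next
    assume "{f u, f v} \<in> F"
    then obtain d where d: "d \<in> edges G" "f ` {u, v} = f ` d" unfolding F_def by auto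
    moreover have "d \<subseteq> verts G" using d(1) G unfolding simple_graph_def by blast
    ultimately have "{u, v} = d"
      using inj_on_image_eq_iff[OF inj, of "{u, v}" d] uv by simp
    then show "{u, v} \<in> edges G" using d by simp
  qed
  have iso: "G \<cong>\<^sub>G ?H" unfolding graph_iso_def H using f iff by blast
  have sH: "simple_graph ?H" using K D unfolding simple_graph_def delete_edges_def by auto
  have "vdegree ?H (f u) = vdegree G u" if u: "u \<in> verts G" for u
  proof -
    have "neighbours ?H (f u) = f ` neighbours G u"
    proof
      show "f ` neighbours G u \<subseteq> neighbours ?H (f u)"
      proof
        fix y assume "y \<in> f ` neighbours G u"
        then obtain v where "{u, v} \<in> edges G" "y = f v" unfolding neighbours_def by blast
        then have "{f u, y} \<in> F" unfolding F_def by (intro image_eqI[of _ _ "{u, v}"]) simp_all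
        then show "y \<in> neighbours ?H (f u)" unfolding neighbours_def H by simp
      qed
      show "neighbours ?H (f u) \<subseteq> f ` neighbours G u"
      proof
        fix y assume y: "y \<in> neighbours ?H (f u)"
        then have "y \<in> f ` verts G"
          using neighbours_subset[OF sH, of "f u"] bij_betw_imp_surj_on[OF f] unfolding H by blast
        then obtain v where "v \<in> verts G" "y = f v" by blast
        then show "y \<in> f ` neighbours G u" using y iff[OF u] unfolding neighbours_def H by simp
      qed
    qed
    moreover have "inj_on f (neighbours G u)"
      by (rule inj_on_subset[OF inj]) (use neighbours_subset[OF G, of u] in blast)
    ultimately show ?thesis
      unfolding vdegree_eq_card_neighbours[OF sH] vdegree_eq_card_neighbours[OF G]
      by (simp add: card_image)
  qed
  then have "vdegree ?H ` verts ?H = vdegree G ` verts G"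
    unfolding H bij_betw_imp_surj_on[OF f, symmetric] image_image by (intro image_cong) simp_all
  then have "min_degree ?H \<ge> 3" using deg unfolding min_degree_def by simp
  moreover have "G \<cong>\<^sub>G K" if "?t = 0"
  proof -
    have "D = {}" using that cD finite_subset[OF D(1) finK] by simp
    then have "?H = K" unfolding delete_edges_def by (cases K) simp
    then show ?thesis using iso by simp
  qed
  ultimately show "G \<in> edge_deleted_family K ?t"
    unfolding edge_deleted_family_def mem_Collect_eq using G D(1) cD iso by (metis (full_types))
qed

lemma sum_image_pair_iff [simp]:
  "{Inl a, Inl b} \<in> (`) Inl ` E \<longleftrightarrow> {a, b} \<in> E" "{Inr a, Inr b} \<in> (`) Inr ` F \<longleftrightarrow> {a, b} \<in> F"
proof -
  have "Inl ` {a, b} \<in> (`) Inl ` E \<longleftrightarrow> {a, b} \<in> E"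
    by (intro inj_image_mem_iff) (simp add: inj_on_def inj_image_eq_iff)
  then show "{Inl a, Inl b} \<in> (`) Inl ` E \<longleftrightarrow> {a, b} \<in> E" by simp
  have "Inr ` {a, b} \<in> (`) Inr ` F \<longleftrightarrow> {a, b} \<in> F"
    by (intro inj_image_mem_iff) (simp add: inj_on_def inj_image_eq_iff)
  then show "{Inr a, Inr b} \<in> (`) Inr ` F \<longleftrightarrow> {a, b} \<in> F" by simp
qed

lemma mixed_image_pair [simp]:
  "{Inl a, x} \<notin> (`) Inr ` F" "{x, Inl a} \<notin> (`) Inr ` F"
  "{Inr b, x} \<notin> (`) Inl ` E" "{x, Inr b} \<notin> (`) Inl ` E"
  by (auto simp: set_eq_iff)

lemma graph_union_edge_iff [simp]:
  "{Inl a, Inl b} \<in> edges (graph_union G H) \<longleftrightarrow> {a, b} \<in> edges G"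
  "{Inr c, Inr d} \<in> edges (graph_union G H) \<longleftrightarrow> {c, d} \<in> edges H"
  "{Inl a, Inr d} \<notin> edges (graph_union G H)"
  "{Inr d, Inl a} \<notin> edges (graph_union G H)"
  unfolding graph_union_def by auto

lemma graph_join_edge_iff [simp]:
  "{Inl a, Inl b} \<in> edges (graph_join G H) \<longleftrightarrow> {a, b} \<in> edges G"
  "{Inr c, Inr d} \<in> edges (graph_join G H) \<longleftrightarrow> {c, d} \<in> edges H"
  "{Inl a, Inr d} \<in> edges (graph_join G H) \<longleftrightarrow> a \<in> verts G \<and> d \<in> verts H"
  "{Inr d, Inl a} \<in> edges (graph_join G H) \<longleftrightarrow> a \<in> verts G \<and> d \<in> verts H"
  unfolding graph_join_def by (auto simp: doubleton_eq_iff)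

lemma complete_graph_edge_iff [simp]:
  "{a, b} \<in> edges (complete_graph n) \<longleftrightarrow> a < n \<and> b < n \<and> a \<noteq> b"
  unfolding complete_graph_def by auto

lemma edges_copies_of_point [simp]: "edges (graph_copies k (complete_graph 1)) = {}"
proof -
  have "edges (complete_graph 1) = {}"
  proof (rule equals0I)
    fix e assume "e \<in> edges (complete_graph 1)"
    then have "e \<subseteq> {0}" "card e = 2" unfolding complete_graph_def by auto
    then show False using card_mono[of "{0}" e] by simp
  qed
  then show ?thesis unfolding graph_copies_def by simp
qed

lemma verts_constructions [simp]:
  "verts (graph_union G H) = verts G <+> verts H"
  "verts (graph_join G H) = verts G <+> verts H"
  "verts (complete_graph n) = {..<n}"
  "verts (graph_copies k G) = {..<k} \<times> verts G"
  unfolding graph_union_def graph_join_def complete_graph_def graph_copies_def by simp_all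

lemma simple_complete_graph: "simple_graph (complete_graph n)"
  unfolding simple_graph_def complete_graph_def by simp

lemma simple_copies_of_point: "simple_graph (graph_copies k (complete_graph 1))"
  unfolding simple_graph_def edges_copies_of_point by simp

lemma simple_graph_union:
  assumes "simple_graph G" "simple_graph H"
  shows "simple_graph (graph_union G H)"
  using assms unfolding simple_graph_def graph_union_def
  by (auto simp: card_image)

lemma simple_graph_join:
  assumes "simple_graph G" "simple_graph H"
  shows "simple_graph (graph_join G H)"
  using assms unfolding simple_graph_def graph_join_def
  by (auto simp: card_image)

text \<open>
  The vertex type of both \<open>S_graph\<close> and \<open>T_graph\<close> is a sum of three parts, so an embedding into
  either of them is assembled from one bijection per part.
\<close>

lemma bij_betw_three_parts:
  assumes "finite W" "finite C" "finite I"
    and "finite X" "finite Y" "finite Z"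
    and "card W = card X" "card C = card Y" "card I = card Z"
    and dis: "W \<inter> C = {}" "W \<inter> I = {}" "C \<inter> I = {}"
  obtains f where "bij_betw f (W \<union> C \<union> I) (X <+> (Y <+> Z))"
    "\<And>x. x \<in> W \<Longrightarrow> f x \<in> Inl ` X" "\<And>x. x \<in> C \<Longrightarrow> f x \<in> Inr ` Inl ` Y"
    "\<And>x. x \<in> I \<Longrightarrow> f x \<in> Inr ` Inr ` Z"
proof -
  obtain w where w: "bij_betw w W X" using finite_same_card_bij[OF assms(1,4,7)] by blast
  obtain c where c: "bij_betw c C Y" using finite_same_card_bij[OF assms(2,5,8)] by blast
  obtain i where i: "bij_betw i I Z" using finite_same_card_bij[OF assms(3,6,9)] by blast
  define f where "f x = (if x \<in> W then Inl (w x) else if x \<in> C then Inr (Inl (c x)) else Inr (Inr (i x)))" for x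
  have W: "f x = Inl (w x)" if "x \<in> W" for x using that by (simp add: f_def)
  have C: "f x = Inr (Inl (c x))" if "x \<in> C" for x using that dis by (auto simp: f_def)
  have I: "f x = Inr (Inr (i x))" if "x \<in> I" for x using that dis by (auto simp: f_def)
  have "bij_betw (Inl \<circ> w) W (Inl ` X)"
    by (rule bij_betw_trans[OF w]) (simp add: bij_betw_def)
  then have fW: "bij_betw f W (Inl ` X)" using W by (simp cong: bij_betw_cong)
  have "bij_betw ((Inr \<circ> Inl) \<circ> c) C (Inr ` Inl ` Y)"
    by (rule bij_betw_trans[OF c]) (simp add: bij_betw_def inj_on_def image_comp)
  then have fC: "bij_betw f C (Inr ` Inl ` Y)" using C by (simp cong: bij_betw_cong)
  have "bij_betw ((Inr \<circ> Inr) \<circ> i) I (Inr ` Inr ` Z)"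
    by (rule bij_betw_trans[OF i]) (simp add: bij_betw_def inj_on_def image_comp)
  then have fI: "bij_betw f I (Inr ` Inr ` Z)" using I by (simp cong: bij_betw_cong)
  have "bij_betw f (W \<union> C) (Inl ` X \<union> Inr ` Inl ` Y)"
    by (rule bij_betw_combine[OF fW fC]) blast
  then have "bij_betw f (W \<union> C \<union> I) (Inl ` X \<union> Inr ` Inl ` Y \<union> Inr ` Inr ` Z)"
    by (rule bij_betw_combine[OF _ fI]) blast
  moreover have "Inl ` X \<union> Inr ` Inl ` Y \<union> Inr ` Inr ` Z = X <+> (Y <+> Z)" by auto
  ultimately have "bij_betw f (W \<union> C \<union> I) (X <+> (Y <+> Z))" by simp
  moreover have "f x \<in> Inl ` X" if "x \<in> W" for x
    using imageI[OF that, of f] bij_betw_imp_surj_on[OF fW] by simp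
  moreover have "f x \<in> Inr ` Inl ` Y" if "x \<in> C" for x
    using imageI[OF that, of f] bij_betw_imp_surj_on[OF fC] by simp
  moreover have "f x \<in> Inr ` Inr ` Z" if "x \<in> I" for x
    using imageI[OF that, of f] bij_betw_imp_surj_on[OF fI] by simp
  ultimately show thesis by (rule that)
qed

lemma simple_S_graph: "simple_graph (S_graph n k)"
  unfolding S_graph_def
  by (intro simple_graph_join simple_graph_union simple_complete_graph simple_copies_of_point)

lemma simple_T_graph: "simple_graph (T_graph n k)"
  unfolding T_graph_def
  by (intro simple_graph_join simple_graph_union simple_complete_graph)

lemma verts_S_graph: "verts (S_graph n k) = {..<k} <+> ({..<n - (2 * k - 1)} <+> ({..<k - 1} \<times> {..<1}))"
  unfolding S_graph_def by simp

lemma verts_T_graph: "verts (T_graph n k) = {..<2} <+> ({..<n - (k + 1)} <+> {..<k - 1})"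
  unfolding T_graph_def by simp

text \<open>
  The \<open>k - 1\<close> isolated vertices of the construction end up with degree \<open>k\<close> and are pairwise
  nonadjacent, while the remaining \<open>n - (k - 1)\<close> vertices form a clique.
\<close>

lemma card_edges_S_graph:
  assumes "1 \<le> k" "2 * k \<le> n"
  shows "card (edges (S_graph n k)) = ((n - (k - 1)) choose 2) + (k - 1) * k"
proof -
  let ?S = "S_graph n k"
  define A :: "(nat + nat + nat \<times> nat) set" where "A = Inr ` Inr ` ({..<k - 1} \<times> {..<1})"
  have A: "A \<subseteq> verts ?S" "finite A" unfolding A_def verts_S_graph by auto
  have cA: "card A = k - 1" unfolding A_def by (simp add: card_image inj_on_def)
  have cV: "card (verts ?S) = n" using assms unfolding verts_S_graph by (simp add: card_Plus)
  have "neighbours ?S a = Inl ` {..<k}" if aA: "a \<in> A" for a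
  proof (rule set_eqI)
    fix y :: "nat + nat + nat \<times> nat"
    obtain x where a: "a = Inr (Inr x)" "x \<in> {..<k - 1} \<times> {..<1}" using aA unfolding A_def by blast
    consider b where "y = Inl b" | b where "y = Inr (Inl b)" | b where "y = Inr (Inr b)"
      by (metis sumE)
    then show "y \<in> neighbours ?S a \<longleftrightarrow> y \<in> Inl ` {..<k}"
      by cases (use a in \<open>auto simp: neighbours_def S_graph_def simp del: One_nat_def\<close>)
  qed
  then have "(\<Sum>a\<in>A. vdegree ?S a) = (k - 1) * k"
    unfolding vdegree_eq_card_neighbours[OF simple_S_graph] using cA by (simp add: card_image)
  moreover have no_inner: "{e \<in> edges ?S. e \<subseteq> A} = {}"
  proof (rule equals0I)
    fix e assume e: "e \<in> {e \<in> edges ?S. e \<subseteq> A}"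
    then have "card e = 2" using simple_S_graph[of n k] unfolding simple_graph_def by blast
    then obtain a b where "e = {a, b}" by (meson card_2_iff)
    then show False using e unfolding A_def S_graph_def by (auto simp del: One_nat_def)
  qed
  moreover have "card {e \<in> edges ?S. e \<inter> A = {}} = (n - (k - 1)) choose 2"
  proof -
    have V: "verts ?S - A = Inl ` {..<k} \<union> Inr ` Inl ` {..<n - (2 * k - 1)}"
      unfolding verts_S_graph A_def by auto
    have "{x, y} \<in> edges ?S" if "x \<in> verts ?S - A" "y \<in> verts ?S - A" "x \<noteq> y" for x y
      using that unfolding V unfolding S_graph_def by (auto simp del: One_nat_def)
    then show ?thesis
      using edges_avoiding_eq_choose[OF simple_S_graph A(1)] cV cA by simp
  qed
  ultimately show ?thesis using edge_count_by_degrees[OF simple_S_graph A(2), of n k]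
    unfolding no_inner by simp
qed

lemma card_edges_T_graph_3:
  assumes "6 \<le> n"
  shows "card (edges (T_graph n 3)) = ((n - 2) choose 2) + 5"
proof -
  let ?T = "T_graph n 3"
  define A :: "(nat + nat + nat) set" where "A = Inr ` Inr ` {..<2}"
  have A: "A \<subseteq> verts ?T" "finite A" unfolding A_def verts_T_graph by auto
  have A2: "A = {Inr (Inr 0), Inr (Inr 1)}" unfolding A_def by (auto simp: lessThan_Suc numeral_2_eq_2)
  have cV: "card (verts ?T) = n" using assms unfolding verts_T_graph by (simp add: card_Plus)
  have cA: "card A = 2" unfolding A2 by simp
  have nb: "neighbours ?T (Inr (Inr x)) = {Inl 0, Inl 1, Inr (Inr (1 - x))}" if "x < 2" for x
  proof (rule set_eqI)
    have x: "x = 0 \<or> x = 1" using that by linarith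
    fix y :: "nat + nat + nat"
    consider b where "y = Inl b" | b where "y = Inr (Inl b)" | b where "y = Inr (Inr b)"
      by (metis sumE)
    then show "y \<in> neighbours ?T (Inr (Inr x)) \<longleftrightarrow> y \<in> {Inl 0, Inl 1, Inr (Inr (1 - x))}"
      by cases (use x in \<open>auto simp: neighbours_def T_graph_def\<close>)
  qed
  have "(\<Sum>a\<in>A. vdegree ?T a) = 6"
    unfolding vdegree_eq_card_neighbours[OF simple_T_graph] A2 using nb[of 0] nb[of 1] by simp
  moreover have "{e \<in> edges ?T. e \<subseteq> A} = {A}"
  proof
    show "{e \<in> edges ?T. e \<subseteq> A} \<subseteq> {A}"
    proof
      fix e assume e: "e \<in> {e \<in> edges ?T. e \<subseteq> A}"
      then have "card e = 2" using simple_T_graph[of n 3] unfolding simple_graph_def by blast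
      then show "e \<in> {A}" using e cA card_subset_eq[OF A(2), of e] by simp
    qed
    show "{A} \<subseteq> {e \<in> edges ?T. e \<subseteq> A}" unfolding A2 T_graph_def by simp
  qed
  moreover have "card {e \<in> edges ?T. e \<inter> A = {}} = (n - 2) choose 2"
  proof -
    have V: "verts ?T - A = Inl ` {..<2} \<union> Inr ` Inl ` {..<n - 4}"
      unfolding verts_T_graph A_def by auto
    have "{x, y} \<in> edges ?T" if "x \<in> verts ?T - A" "y \<in> verts ?T - A" "x \<noteq> y" for x y
      using that unfolding V unfolding T_graph_def by auto
    then show ?thesis
      using edges_avoiding_eq_choose[OF simple_T_graph A(1)] cV cA by simp
  qed
  ultimately show ?thesis using edge_count_by_degrees[OF simple_T_graph A(2), of n 3] by simp
qed

text \<open>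
  Mapping \<open>W\<close>, \<open>I\<close> and the remaining vertices to the three parts of \<open>S_graph n k\<close> preserves edges,
  because the only pairs missing in \<open>S_graph n k\<close> have an end in the image of \<open>I\<close> and none in that
  of \<open>W\<close>.
\<close>

lemma S_family_if_partition:
  assumes G: "simple_graph G" and deg: "min_degree G \<ge> 3" and n: "card (verts G) = n"
    and k: "1 \<le> k" "2 * k \<le> n"
    and W: "W \<subseteq> verts G" "card W = k" and I: "I \<subseteq> verts G" "card I = k - 1" and "W \<inter> I = {}"
    and I_nb: "\<And>x y. x \<in> I \<Longrightarrow> {x, y} \<in> edges G \<Longrightarrow> y \<in> W"
  shows "card (edges G) \<le> card (edges (S_graph n k))"
    and "G \<in> S_family n k (card (edges (S_graph n k)) - card (edges G))"
proof -
  define C where "C = verts G - W - I"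
  have fV: "finite (verts G)" using G unfolding simple_graph_def by blast
  have fin: "finite W" "finite I" "finite C"
    using finite_subset[OF W(1) fV] finite_subset[OF I(1) fV] fV unfolding C_def by simp_all
  have V: "verts G = W \<union> C \<union> I" using W I unfolding C_def by blast
  have dis: "W \<inter> C = {}" "W \<inter> I = {}" "C \<inter> I = {}" using \<open>W \<inter> I = {}\<close> unfolding C_def by blast+
  have "card (verts G) = card W + card C + card I"
    unfolding V using fin dis by (simp add: card_Un_disjoint Int_Un_distrib2)
  then have cC: "card C = n - (2 * k - 1)" using n W(2) I(2) k by simp
  obtain f where f: "bij_betw f (W \<union> C \<union> I) ({..<k} <+> ({..<n - (2 * k - 1)} <+> ({..<k - 1} \<times> {..<1::nat})))"
    and fW: "\<And>x. x \<in> W \<Longrightarrow> f x \<in> Inl ` {..<k}"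
    and fC: "\<And>x. x \<in> C \<Longrightarrow> f x \<in> Inr ` Inl ` {..<n - (2 * k - 1)}"
    and fI: "\<And>x. x \<in> I \<Longrightarrow> f x \<in> Inr ` Inr ` ({..<k - 1} \<times> {..<1})"
    using bij_betw_three_parts[of W C I "{..<k}" "{..<n - (2 * k - 1)}" "{..<k - 1} \<times> {..<1::nat}"]
      fin dis W(2) I(2) cC by auto
  have bij: "bij_betw f (verts G) (verts (S_graph n k))" using f unfolding V verts_S_graph .
  have hom: "{f u, f v} \<in> edges (S_graph n k)" if e: "{u, v} \<in> edges G" for u v
  proof -
    have uv: "u \<in> verts G" "v \<in> verts G" "u \<noteq> v" using simple_graph_edgeD[OF G e] .
    then have "f u \<noteq> f v" using bij unfolding bij_betw_def inj_on_def by blast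
    moreover have "u \<in> I \<Longrightarrow> v \<in> W" "v \<in> I \<Longrightarrow> u \<in> W"
      using I_nb[of u v] I_nb[of v u] e by (simp_all add: insert_commute)
    moreover have "u \<in> W \<or> u \<in> C \<or> u \<in> I" "v \<in> W \<or> v \<in> C \<or> v \<in> I" using uv V by auto
    ultimately consider "u \<in> W" "v \<in> W" | "u \<in> W" "v \<in> C" | "u \<in> W" "v \<in> I"
      | "u \<in> C" "v \<in> W" | "u \<in> C" "v \<in> C" | "u \<in> I" "v \<in> W" by blast
    then show ?thesis
      by cases (use \<open>f u \<noteq> f v\<close> in
        \<open>auto dest!: fW fC fI simp: S_graph_def simp del: One_nat_def\<close>)
  qed
  note emb = edge_deleted_family_if_embedding[OF G simple_S_graph bij hom deg]
  show "card (edges G) \<le> card (edges (S_graph n k))" using emb(1) .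
  show "G \<in> S_family n k (card (edges (S_graph n k)) - card (edges G))"
    unfolding S_family_def using emb(2) .
qed

lemma T_family_if_partition:
  assumes G: "simple_graph G" and deg: "min_degree G \<ge> 3" and n: "card (verts G) = n"
    and k: "1 \<le> k" "k + 1 \<le> n"
    and W: "W \<subseteq> verts G" "card W = 2" and P: "P \<subseteq> verts G" "card P = k - 1" and "W \<inter> P = {}"
    and P_nb: "\<And>x y. x \<in> P \<Longrightarrow> {x, y} \<in> edges G \<Longrightarrow> y \<in> W \<union> P"
  shows "card (edges G) \<le> card (edges (T_graph n k))"
    and "G \<in> T_family n k (card (edges (T_graph n k)) - card (edges G))"
proof -
  define C where "C = verts G - W - P"
  have fV: "finite (verts G)" using G unfolding simple_graph_def by blast
  have fin: "finite W" "finite P" "finite C"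
    using finite_subset[OF W(1) fV] finite_subset[OF P(1) fV] fV unfolding C_def by simp_all
  have V: "verts G = W \<union> C \<union> P" using W P unfolding C_def by blast
  have dis: "W \<inter> C = {}" "W \<inter> P = {}" "C \<inter> P = {}" using \<open>W \<inter> P = {}\<close> unfolding C_def by blast+
  have "card (verts G) = card W + card C + card P"
    unfolding V using fin dis by (simp add: card_Un_disjoint Int_Un_distrib2)
  then have cC: "card C = n - (k + 1)" using n W(2) P(2) k by simp
  obtain f where f: "bij_betw f (W \<union> C \<union> P) ({..<2::nat} <+> ({..<n - (k + 1)} <+> {..<k - 1}))"
    and fW: "\<And>x. x \<in> W \<Longrightarrow> f x \<in> Inl ` {..<2}"
    and fC: "\<And>x. x \<in> C \<Longrightarrow> f x \<in> Inr ` Inl ` {..<n - (k + 1)}"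
    and fP: "\<And>x. x \<in> P \<Longrightarrow> f x \<in> Inr ` Inr ` {..<k - 1}"
    using bij_betw_three_parts[of W C P "{..<2::nat}" "{..<n - (k + 1)}" "{..<k - 1}"]
      fin dis W(2) P(2) cC by auto
  have bij: "bij_betw f (verts G) (verts (T_graph n k))" using f unfolding V verts_T_graph .
  have hom: "{f u, f v} \<in> edges (T_graph n k)" if e: "{u, v} \<in> edges G" for u v
  proof -
    have uv: "u \<in> verts G" "v \<in> verts G" "u \<noteq> v" using simple_graph_edgeD[OF G e] .
    then have "f u \<noteq> f v" using bij unfolding bij_betw_def inj_on_def by blast
    moreover have "u \<in> P \<Longrightarrow> v \<in> W \<union> P" "v \<in> P \<Longrightarrow> u \<in> W \<union> P"
      using P_nb[of u v] P_nb[of v u] e by (simp_all add: insert_commute)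
    moreover have "u \<in> W \<or> u \<in> C \<or> u \<in> P" "v \<in> W \<or> v \<in> C \<or> v \<in> P" using uv V by auto
    ultimately consider "u \<in> W" "v \<in> W" | "u \<in> W" "v \<in> C" | "u \<in> W" "v \<in> P"
      | "u \<in> C" "v \<in> W" | "u \<in> C" "v \<in> C" | "u \<in> P" "v \<in> W" | "u \<in> P" "v \<in> P" by blast
    then show ?thesis
      by cases (use \<open>f u \<noteq> f v\<close> in \<open>auto dest!: fW fC fP simp: T_graph_def\<close>)
  qed
  note emb = edge_deleted_family_if_embedding[OF G simple_T_graph bij hom deg]
  show "card (edges G) \<le> card (edges (T_graph n k))" using emb(1) .
  show "G \<in> T_family n k (card (edges (T_graph n k)) - card (edges G))"
    unfolding T_family_def using emb(2) .
qed

section \<open>Structure of closed graphs with many edges\<close>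

text \<open>
  A vertex \<open>w\<close> of the clique outside \<open>A\<close> with a neighbour in \<open>A\<close> has degree at least \<open>n - card A\<close>. This
  is large enough for closedness to forbid missing edges between \<open>w\<close> and vertices of degree at
  least \<open>k\<close>. Hence vertices of \<open>A\<close> of such degree share their neighbours outside \<open>A\<close>.
\<close>

lemma uniform_neighbourhoods:
  assumes H: "simple_graph H"
    and closed: "degree_sum_closed H"
    and A: "A \<subseteq> verts H" "card A + 1 \<le> k"
    and complete: "\<And>x y. x \<in> verts H - A \<Longrightarrow> y \<in> verts H - A \<Longrightarrow> x \<noteq> y \<Longrightarrow> {x, y} \<in> edges H"
    and a: "a \<in> A" and b: "b \<in> A" "vdegree H b \<ge> k"
    and w: "w \<in> verts H - A" "{a, w} \<in> edges H"
  shows "{b, w} \<in> edges H"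
proof (rule ccontr)
  assume nadj: "{b, w} \<notin> edges H"
  have fin: "finite (verts H)" using H unfolding simple_graph_def by blast
  have "insert a (verts H - A - {w}) \<subseteq> neighbours H w"
    using complete w unfolding neighbours_def by (auto simp: insert_commute)
  then have "card (insert a (verts H - A - {w})) \<le> vdegree H w"
    unfolding vdegree_eq_card_neighbours[OF H] by (rule card_mono[OF finite_neighbours[OF H]])
  moreover have "card (insert a (verts H - A - {w})) = Suc (card (verts H - A - {w}))"
    using fin a by simp
  moreover have "Suc (card (verts H - A - {w})) = card (verts H - A)"
    using fin w(1) by (intro card_Suc_Diff1) simp_all
  moreover have "card (verts H - A) = card (verts H) - card A"
    using finite_subset[OF A(1) fin] A(1) by (rule card_Diff_subset)
  moreover have "card A \<le> card (verts H)" using fin A(1) by (rule card_mono)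
  moreover have "vdegree H b + vdegree H w \<le> card (verts H)"
    using degree_sum_closedD[OF closed, of b w] nadj A(1) b(1) w(1) by blast
  ultimately show False using A(2) b(2) by linarith
qed

text \<open>
  A missing edge \<open>xy\<close> outside \<open>A\<close> would have degree sum at most \<open>n\<close>; then the four vertices in
  \<open>A \<union> {x, y}\<close> meet at most \<open>n + 6\<close> edges, too few for the edge bound when \<open>n \<ge> 11\<close>. So the
  vertices outside \<open>A\<close> form a clique, and the two vertices of \<open>A\<close> have the same neighbours there.
  Depending on whether they are adjacent, there are two or three common neighbours, which is the
  shape of \<open>T_graph n 3\<close> or \<open>S_graph n 3\<close>.
\<close>

lemma low_pair_structure:
  assumes H: "simple_graph H"
    and closed: "degree_sum_closed H"
    and n: "card (verts H) \<ge> 11"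
    and A: "A \<subseteq> verts H" "card A = 2" "\<And>a. a \<in> A \<Longrightarrow> vdegree H a = 3"
    and m: "card (edges H) \<ge> ((card (verts H) - 2) choose 2) + 3"
  obtains W where "W \<subseteq> verts H - A"
    "card W = 3 \<and> (\<forall>x y. x \<in> A \<longrightarrow> {x, y} \<in> edges H \<longrightarrow> y \<in> W)
     \<or> card W = 2 \<and> (\<forall>x y. x \<in> A \<longrightarrow> {x, y} \<in> edges H \<longrightarrow> y \<in> W \<union> A)"
proof -
  let ?n = "card (verts H)"
  obtain a b where ab: "A = {a, b}" "a \<noteq> b" using A(2) by (meson card_2_iff)
  have complete: "{x, y} \<in> edges H" if xy: "x \<in> verts H - A" "y \<in> verts H - A" "x \<noteq> y" for x y
  proof (rule ccontr)
    assume "{x, y} \<notin> edges H"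
    then have d: "vdegree H x + vdegree H y \<le> ?n" using degree_sum_closedD[OF closed, of x y] xy by simp
    have "card {a, b, x, y} = 4" using xy ab by auto
    moreover have "(\<Sum>v\<in>{a, b, x, y}. vdegree H v) = 6 + vdegree H x + vdegree H y"
      using xy ab A(3)[of a] A(3)[of b] by auto
    moreover have "{a, b, x, y} \<subseteq> verts H" using xy ab A(1) by simp
    ultimately have "card (edges H) \<le> ((?n - 4) choose 2) + 6 + ?n"
      using edge_count_upper_bound[OF H, of "{a, b, x, y}"] d by simp
    moreover define j where "j = ?n - 4"
    then have j: "?n = j + 4" using n by simp
    then have "?n - 2 = Suc (Suc j)" "?n - 4 = j" by simp_all
    moreover have "Suc (Suc j) choose 2 = (j choose 2) + j + Suc j"
      by (simp add: numeral_2_eq_2)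
    ultimately show False using m n j by simp
  qed
  have same: "neighbours H a - {b} = neighbours H b - {a}"
  proof -
    have "{c, w} \<in> edges H" if c: "c \<in> A" "c' \<in> A" "{c', w} \<in> edges H" "w \<notin> A" for c c' w
    proof -
      have "card A + 1 \<le> 3" "3 \<le> vdegree H c" "w \<in> verts H - A"
        using A(2) A(3)[OF c(1)] c(4) simple_graph_edgeD[OF H c(3)] by simp_all
      then show ?thesis
        using uniform_neighbourhoods[OF H closed A(1) _ complete c(2,1) _ _ c(3), of 3] by blast
    qed
    then have *: "w \<in> neighbours H c" if "c \<in> A" "c' \<in> A" "w \<in> neighbours H c'" "w \<notin> A" for c c' w
      using that unfolding neighbours_def by blast
    have "a \<in> A" "b \<in> A" using ab by simp_all
    note *[OF this] *[OF this(2,1)]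
    then have "w \<in> neighbours H a \<longleftrightarrow> w \<in> neighbours H b" if "w \<notin> A" for w
      using that by blast
    moreover have "a \<notin> neighbours H a" "b \<notin> neighbours H b"
      using neighbours_subset[OF H, of a] neighbours_subset[OF H, of b] by blast+
    ultimately have "w \<in> neighbours H a - {b} \<longleftrightarrow> w \<in> neighbours H b - {a}" for w
      unfolding ab(1) by (cases "w = a"; cases "w = b") simp_all
    then show ?thesis by (rule set_eqI)
  qed
  let ?W = "neighbours H a - {b}"
  have W: "?W \<subseteq> verts H - A" using neighbours_subset[OF H, of a] ab by blast
  have N: "card (neighbours H a) = 3"
    using A(3)[of a] ab vdegree_eq_card_neighbours[OF H, of a] by simp
  show thesis
  proof (cases "{a, b} \<in> edges H")
    case True
    then have "b \<in> neighbours H a" unfolding neighbours_def by simp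
    then have "card ?W = 2" using N by simp
    moreover have "y \<in> ?W \<union> A" if "x \<in> A" "{x, y} \<in> edges H" for x y
      using that same ab unfolding neighbours_def by blast
    ultimately show thesis using that[OF W] by blast
  next
    case False
    then have "b \<notin> neighbours H a" "a \<notin> neighbours H b"
      unfolding neighbours_def by (simp_all add: insert_commute)
    then have W': "?W = neighbours H a" "?W = neighbours H b" using same by simp_all
    have "y \<in> ?W" if "x \<in> A" "{x, y} \<in> edges H" for x y
      using that W' ab unfolding neighbours_def by blast
    moreover have "card ?W = 3" using N W'(1) by simp
    ultimately show thesis using that[OF W] by blast
  qed
qed

text \<open>
  The edge count is at its maximum, so all inequalities in its derivation are equalities: \<open>A\<close> is
  independent, its vertices have degree exactly \<open>k\<close>, and the other vertices form a clique. The
  neighbourhoods of the vertices of \<open>A\<close> then coincide.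
\<close>

lemma extremal_structure:
  assumes H: "simple_graph H"
    and closed: "degree_sum_closed H"
    and k: "k \<ge> 2"
    and A: "A \<subseteq> verts H" "card A = k - 1" "\<And>a. a \<in> A \<Longrightarrow> vdegree H a \<le> k"
    and m: "card (edges H) \<ge> ((card (verts H) - (k - 1)) choose 2) + (k - 1) * k"
  obtains W where "W \<subseteq> verts H - A" "card W = k"
    "\<And>x y. x \<in> A \<Longrightarrow> {x, y} \<in> edges H \<Longrightarrow> y \<in> W"
proof -
  have fin: "finite (verts H)" using H unfolding simple_graph_def by blast
  have finA: "finite A" using A(1) fin by (rule finite_subset)
  have sum: "(\<Sum>a\<in>A. vdegree H a) \<le> (k - 1) * k"
    using sum_mono[of A "vdegree H" "\<lambda>_. k"] A(2,3) by simp
  note count = edge_count_by_degrees[OF H finA]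
  note inner = edges_avoiding_le_choose[OF H A(1)]
  have sum_eq: "(\<Sum>a\<in>A. vdegree H a) = (k - 1) * k" and "card {e \<in> edges H. e \<subseteq> A} = 0"
    and rest: "card {e \<in> edges H. e \<inter> A = {}} = (card (verts H) - card A) choose 2"
    using count inner(1) sum m unfolding A(2) by linarith+
  then have indep: "{e \<in> edges H. e \<subseteq> A} = {}" using finite_edges[OF H] by simp
  have deg: "vdegree H a = k" if "a \<in> A" for a
    by (rule sum_mono_inv[of "vdegree H" A "\<lambda>_. k"])
      (use sum_eq A(2,3) that finA in simp_all)
  have out: "y \<in> verts H - A" if "x \<in> A" "{x, y} \<in> edges H" for x y
    using indep that simple_graph_edgeD[OF H that(2)] by blast
  have "A \<noteq> {}" using A(2) k by force
  then obtain a where a: "a \<in> A" by blast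
  show thesis
  proof (rule that[of "neighbours H a"])
    show "neighbours H a \<subseteq> verts H - A" using out[OF a] unfolding neighbours_def by blast
    show "card (neighbours H a) = k" using deg[OF a] vdegree_eq_card_neighbours[OF H, of a] by simp
    fix x y assume x: "x \<in> A" "{x, y} \<in> edges H"
    have "{a, y} \<in> edges H"
    proof (rule uniform_neighbourhoods[OF H closed A(1) _ inner(2)[OF rest] x(1) a _ out[OF x] x(2)])
      show "card A + 1 \<le> k" "k \<le> vdegree H a" using A(2) k deg[OF a] by simp_all
    qed
    then show "y \<in> neighbours H a" unfolding neighbours_def by simp
  qed
qed

text \<open>
  Here the number of edges may be one below the maximum \<open>(k choose 2) + k * k\<close>. A single edge \<open>xy\<close>
  inside \<open>U\<close> uses up this slack: the other half \<open>W\<close> is a clique, all degrees in \<open>U\<close> are \<open>k\<close>, and \<open>xy\<close>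
  is the only edge inside \<open>U\<close>. Every vertex of \<open>U\<close> other than \<open>x\<close> and \<open>y\<close> is then joined to all of
  \<open>W\<close>, whereas \<open>x\<close> misses some \<open>w \<in> W\<close>. But \<open>w\<close> has degree at least \<open>(k - 1) + (k - 2)\<close>, and together
  with the \<open>k\<close> neighbours of \<open>x\<close> this exceeds \<open>2 * k\<close>.
\<close>

lemma low_half_independent:
  assumes H: "simple_graph H"
    and closed: "degree_sum_closed H"
    and k: "k > 3" and n: "card (verts H) = 2 * k"
    and U: "U \<subseteq> verts H" "card U = k" "\<And>a. a \<in> U \<Longrightarrow> vdegree H a \<le> k"
    and m: "card (edges H) + 1 \<ge> (k choose 2) + k * k"
    and x: "x \<in> U" and xy: "{x, y} \<in> edges H"
  shows "y \<in> verts H - U"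
proof (rule ccontr)
  assume "y \<notin> verts H - U"
  then have y: "y \<in> U" and "x \<noteq> y" using simple_graph_edgeD[OF H xy] by blast+
  have fin: "finite (verts H)" using H unfolding simple_graph_def by blast
  have finU: "finite U" using U(1) fin by (rule finite_subset)
  let ?I = "{e \<in> edges H. e \<subseteq> U}"
  have xyI: "{x, y} \<in> ?I" using x y xy by simp
  have finI: "finite ?I" using finite_edges[OF H] by simp
  have I1: "card ?I \<ge> 1" using card_mono[OF finI, of "{{x, y}}"] xyI by simp
  have sum: "(\<Sum>a\<in>U. vdegree H a) \<le> k * k"
    using sum_mono[of U "vdegree H" "\<lambda>_. k"] U(2,3) by simp
  note count = edge_count_by_degrees[OF H finU]
  note inner = edges_avoiding_le_choose[OF H U(1)]
  have half: "card (verts H) - card U = k" using n U(2) by simp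
  have sum_eq: "(\<Sum>a\<in>U. vdegree H a) = k * k" and "card ?I = 1"
    and rest: "card {e \<in> edges H. e \<inter> U = {}} = (card (verts H) - card U) choose 2"
    using count inner(1) sum m I1 unfolding half by linarith+
  obtain e where "?I = {e}" using \<open>card ?I = 1\<close> by (rule card_1_singletonE)
  then have I: "?I = {{x, y}}" using xyI by simp
  have deg: "vdegree H a = k" if "a \<in> U" for a
    by (rule sum_mono_inv[of "vdegree H" U "\<lambda>_. k"])
      (use sum_eq U(2,3) that finU in simp_all)
  let ?W = "verts H - U"
  have cW: "card ?W = k" using half card_Diff_subset[OF finU U(1)] by simp
  have finW: "finite ?W" using fin by simp
  have full: "neighbours H a = ?W" if a: "a \<in> U - {x, y}" for a
  proof (rule card_subset_eq[OF finW])
    show "neighbours H a \<subseteq> ?W"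
    proof
      fix w assume "w \<in> neighbours H a"
      then have aw: "{a, w} \<in> edges H" unfolding neighbours_def by simp
      have "w \<notin> U"
      proof
        assume "w \<in> U"
        then have "{a, w} \<in> ?I" using a aw by simp
        then show False using a I by (auto simp: doubleton_eq_iff)
      qed
      then show "w \<in> ?W" using simple_graph_edgeD[OF H aw] by blast
    qed
    show "card (neighbours H a) = card ?W"
      using a deg[of a] vdegree_eq_card_neighbours[OF H, of a] cW by simp
  qed
  have "\<not> ?W \<subseteq> neighbours H x"
  proof
    assume "?W \<subseteq> neighbours H x"
    then have "insert y ?W \<subseteq> neighbours H x" using xy unfolding neighbours_def by simp
    then have "card (insert y ?W) \<le> vdegree H x"
      unfolding vdegree_eq_card_neighbours[OF H] by (rule card_mono[OF finite_neighbours[OF H]])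
    then show False using finW y cW deg[OF x] by simp
  qed
  then obtain w where w: "w \<in> ?W" "{x, w} \<notin> edges H" unfolding neighbours_def by blast
  have "(?W - {w}) \<union> (U - {x, y}) \<subseteq> neighbours H w"
  proof
    fix z assume "z \<in> (?W - {w}) \<union> (U - {x, y})"
    then consider "z \<in> ?W" "z \<noteq> w" | "z \<in> U - {x, y}" by blast
    then show "z \<in> neighbours H w"
    proof cases
      case 1
      then show ?thesis using inner(2)[OF rest w(1) 1(1)] unfolding neighbours_def by simp
    next
      case 2
      then show ?thesis using full[OF 2] w(1) neighbours_sym[of z H w] by simp
    qed
  qed
  then have "card ((?W - {w}) \<union> (U - {x, y})) \<le> vdegree H w"
    unfolding vdegree_eq_card_neighbours[OF H] by (rule card_mono[OF finite_neighbours[OF H]])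
  moreover have "card ((?W - {w}) \<union> (U - {x, y})) = card (?W - {w}) + card (U - {x, y})"
    using finU finW by (intro card_Un_disjoint) auto
  moreover have "card (?W - {w}) = k - 1" using w(1) cW finW by simp
  moreover have "card (U - {x, y}) = k - 2"
    using x y \<open>x \<noteq> y\<close> finU U(2) by (simp add: card_Diff_subset)
  moreover have "vdegree H x + vdegree H w \<le> 2 * k"
    using degree_sum_closedD[OF closed, of x w] w x U(1) unfolding n by blast
  ultimately show False using deg[OF x] k by simp
qed

section \<open>Hamilton-connectedness from the number of edges\<close>

text \<open>
  The hypothesis compares the edge numbers of \<open>S_graph n k\<close> and \<open>S_graph n 3\<close>, the latter reduced by
  three. The difference factors, and the inequality becomes \<open>(k - 3) * (2 * n - 3 * k - 6) \<le> 6\<close>.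
  Since \<open>n \<ge> 2 * k\<close>, the product is at least \<open>(k - 3) * (k - 6)\<close>, which rules out \<open>k \<ge> 9\<close>.
\<close>

lemma exceptional_parameters:
  fixes n k :: nat
  assumes k: "3 \<le> k" "2 * k \<le> n" and n: "13 \<le> n"
    and le: "((n - 2) choose 2) + 3 \<le> ((n - (k - 1)) choose 2) + (k - 1) * k"
  shows "k = 3 \<or> n = 13 \<and> k = 6 \<or> n = 14 \<and> k = 7"
proof -
  have two: "2 * int (m choose 2) = int m * (int m - 1)" for m
  proof (induction m)
    case 0
    then show ?case by simp
  next
    case (Suc m)
    have "Suc m choose 2 = m + (m choose 2)" by (simp add: numeral_2_eq_2)
    then show ?case using Suc by (simp add: algebra_simps)
  qed
  let ?n = "int n" and ?k = "int k"
  have "2 * (int ((n - 2) choose 2) + 3) \<le> 2 * (int ((n - (k - 1)) choose 2) + int ((k - 1) * k))"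
  proof -
    have "int (((n - 2) choose 2) + 3) \<le> int (((n - (k - 1)) choose 2) + (k - 1) * k)"
      using le by (simp only: of_nat_le_iff)
    then have "int ((n - 2) choose 2) + 3 \<le> int ((n - (k - 1)) choose 2) + int ((k - 1) * k)"
      by (simp only: of_nat_add of_nat_numeral)
    then show ?thesis by (rule mult_left_mono) simp
  qed
  moreover have "int (n - 2) = ?n - 2" "int (n - (k - 1)) = ?n - ?k + 1"
    "int ((k - 1) * k) = (?k - 1) * ?k"
    using k n by (simp_all add: of_nat_diff)
  ultimately have "(?n - 2) * (?n - 3) + 6 \<le> (?n - ?k + 1) * (?n - ?k) + 2 * ((?k - 1) * ?k)"
    using two[of "n - 2"] two[of "n - (k - 1)"] by (simp add: algebra_simps)
  then have key: "(?k - 3) * (2 * ?n - 3 * ?k - 6) \<le> 6" by (simp add: algebra_simps)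
  show ?thesis
  proof (cases "k \<ge> 9")
    case True
    then have "6 * 3 \<le> (?k - 3) * (2 * ?n - 3 * ?k - 6)" using k by (intro mult_mono) simp_all
    then show ?thesis using key by linarith
  next
    case False
    then have "k = 3 \<or> k = 4 \<or> k = 5 \<or> k = 6 \<or> k = 7 \<or> k = 8" using k by linarith
    then show ?thesis using key k n by (elim disjE) simp_all
  qed
qed

lemma min_degree_ge_iff:
  assumes "finite (verts G)" "verts G \<noteq> {}"
  shows "d \<le> min_degree G \<longleftrightarrow> (\<forall>v \<in> verts G. d \<le> vdegree G v)"
  unfolding min_degree_def using assms by simp

theorem corollary1p5:
  fixes G :: "'a sgraph" and n m :: nat
  assumes "simple_graph G"
    and "connected_graph G"
    and "card (verts G) = n"
    and "card (edges G) = m"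
    and "n \<ge> 13"
    and "min_degree G \<ge> 3"
    and "m \<ge> ((n - 2) choose 2) + 3"
    and "\<not> (G \<in> (\<Union>i\<in>{0..3}. S_family n 3 i) \<union> (\<Union>i\<in>{0..2}. T_family n 3 i)
           \<or> (n = 13 \<and> G \<cong>\<^sub>G S_graph 13 6)
           \<or> (n = 14 \<and> G \<in> (\<Union>i\<in>{0..1}. S_family 14 7 i)))"
  shows "hamilton_connected G"
proof (rule ccontr)
  assume nhc: "\<not> hamilton_connected G"
  note G = assms(1) and cV = assms(3) and mG = assms(4) and n = assms(5) and deg = assms(6)
    and m = assms(7)
  have finV: "finite (verts G)" using G unfolding simple_graph_def by blast
  obtain H where H: "simple_graph H" and VH: "verts H = verts G" and sub: "edges G \<subseteq> edges H"
    and nhcH: "\<not> hamilton_connected H"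
    and closed: "degree_sum_closed H"
    using maximal_non_hamilton_connected[OF G nhc] by blast
  have cVH: "card (verts H) = n" using VH cV by simp
  have mH: "card (edges H) \<ge> m" using card_mono[OF finite_edges[OF H] sub] mG by simp
  have "verts G \<noteq> {}" using cV n by force
  then have degG: "3 \<le> vdegree G v" if "v \<in> verts G" for v
    using deg min_degree_ge_iff[OF finV] that by blast
  have degH: "3 \<le> vdegree H v" if "v \<in> verts H" for v
  proof -
    have "{e \<in> edges G. v \<in> e} \<subseteq> {e \<in> edges H. v \<in> e}" using sub by blast
    moreover have "finite {e \<in> edges H. v \<in> e}" using finite_edges[OF H] by simp
    ultimately have "vdegree G v \<le> vdegree H v" unfolding vdegree_def by (intro card_mono)
    then show ?thesis using degG[of v] that VH by simp
  qed
  obtain z A U where z: "z \<in> verts H" "2 * vdegree H z \<le> n"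
    and A: "A \<subseteq> verts H" "card A = vdegree H z - 1" "\<And>a. a \<in> A \<Longrightarrow> vdegree H a \<le> vdegree H z"
    and U: "U \<subseteq> verts H" "card U = n - vdegree H z" "\<And>w. w \<in> U \<Longrightarrow> vdegree H w \<le> n - vdegree H z"
    by (rule low_degree_sets[OF H nhcH closed, unfolded cVH]) (rule that)
  define k where "k = vdegree H z"
  have k: "3 \<le> k" "2 * k \<le> n" using degH[OF z(1)] z(2) unfolding k_def by simp_all
  note A = A[folded k_def] and U = U[folded k_def]
  have "(\<Sum>a\<in>A. vdegree H a) \<le> (k - 1) * k"
    using sum_mono[of A "vdegree H" "\<lambda>_. k"] A(2,3) by simp
  then have bound: "card (edges H) \<le> ((n - (k - 1)) choose 2) + (k - 1) * k"
    using edge_count_upper_bound[OF H A(1)] A(2) unfolding cVH by simp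
  note S_part = S_family_if_partition[OF G deg cV]
  have "k = 3 \<or> n = 13 \<and> k = 6 \<or> n = 14 \<and> k = 7"
    using exceptional_parameters[OF k n] bound mH m by simp
  then consider (pair) "k = 3" | (odd) "n = 13" "k = 6" | (balanced) "n = 14" "k = 7" by blast
  then show False
  proof cases
    case pair
    have dA: "vdegree H a = 3" if "a \<in> A" for a
      using A(3)[OF that] degH[OF subsetD[OF A(1) that]] pair by simp
    have A2: "card A = 2" using A(2) pair by simp
    obtain W where W: "W \<subseteq> verts H - A" and
      cases: "card W = 3 \<and> (\<forall>x y. x \<in> A \<longrightarrow> {x, y} \<in> edges H \<longrightarrow> y \<in> W)
        \<or> card W = 2 \<and> (\<forall>x y. x \<in> A \<longrightarrow> {x, y} \<in> edges H \<longrightarrow> y \<in> W \<union> A)"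
    proof -
      have "11 \<le> card (verts H)" "((card (verts H) - 2) choose 2) + 3 \<le> card (edges H)"
        using n mH m unfolding cVH by simp_all
      from low_pair_structure[OF H closed this(1) A(1) A2 dA this(2)] that show thesis by metis
    qed
    have sets: "W \<subseteq> verts G" "A \<subseteq> verts G" "W \<inter> A = {}" using W A(1) VH by auto
    have A2': "card A = 3 - 1" using A2 by simp
    have n3: "1 \<le> (3 :: nat)" "2 * 3 \<le> n" "3 + 1 \<le> n" using n by simp_all
    from cases show False
    proof (elim disjE conjE)
      assume W3: "card W = 3" and "\<forall>x y. x \<in> A \<longrightarrow> {x, y} \<in> edges H \<longrightarrow> y \<in> W"
      then have nb: "\<And>x y. x \<in> A \<Longrightarrow> {x, y} \<in> edges G \<Longrightarrow> y \<in> W" using sub by blast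
      note S_part[OF n3(1,2) sets(1) W3 sets(2) A2' sets(3) nb]
      moreover have "card (edges (S_graph n 3)) = ((n - 2) choose 2) + 6"
        using card_edges_S_graph[of 3 n] n by simp
      ultimately have "\<exists>i\<in>{0..3}. G \<in> S_family n 3 i"
        using m mG by (intro bexI[of _ "card (edges (S_graph n 3)) - card (edges G)"]) simp_all
      then show False using assms(8) by blast
    next
      assume W2: "card W = 2" and "\<forall>x y. x \<in> A \<longrightarrow> {x, y} \<in> edges H \<longrightarrow> y \<in> W \<union> A"
      then have nb: "\<And>x y. x \<in> A \<Longrightarrow> {x, y} \<in> edges G \<Longrightarrow> y \<in> W \<union> A" using sub by blast
      note T_family_if_partition[OF G deg cV n3(1,3) sets(1) W2 sets(2) A2' sets(3) nb]
      moreover have "card (edges (T_graph n 3)) = ((n - 2) choose 2) + 5"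
        using card_edges_T_graph_3[of n] n by simp
      ultimately have "\<exists>i\<in>{0..2}. G \<in> T_family n 3 i"
        using m mG by (intro bexI[of _ "card (edges (T_graph n 3)) - card (edges G)"]) simp_all
      then show False using assms(8) by blast
    qed
  next
    case odd
    have c: "(8 :: nat) choose 2 = 28" "(11 :: nat) choose 2 = 55" by (simp_all add: choose_two)
    note A = A[unfolded odd]
    have large: "((card (verts H) - (6 - 1)) choose 2) + (6 - 1) * 6 \<le> card (edges H)"
      using mH m c unfolding cVH odd by simp
    obtain W where W: "W \<subseteq> verts H - A" "card W = 6"
      and nb: "\<And>x y. x \<in> A \<Longrightarrow> {x, y} \<in> edges H \<Longrightarrow> y \<in> W"
      by (rule extremal_structure[OF H closed _ A large]) simp_all
    have sets: "W \<subseteq> verts G" "A \<subseteq> verts G" "W \<inter> A = {}" using W A(1) VH by auto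
    have n6: "1 \<le> (6 :: nat)" "2 * 6 \<le> n" using n by simp_all
    have nbG: "\<And>x y. x \<in> A \<Longrightarrow> {x, y} \<in> edges G \<Longrightarrow> y \<in> W" using nb sub by blast
    have "card (edges (S_graph 13 6)) = 58" using card_edges_S_graph[of 6 13] c by simp
    moreover have "m \<ge> 58" using m odd c by simp
    moreover note S_part[OF n6 sets(1) W(2) sets(2) A(2) sets(3) nbG]
    ultimately have "G \<in> S_family 13 6 0" using mG odd by simp
    \<comment> \<open>Equality of the edge numbers leaves no edge to delete.\<close>
    then have "G \<cong>\<^sub>G S_graph 13 6" unfolding S_family_def edge_deleted_family_def by simp
    then show False using assms(8) odd by blast
  next
    case balanced
    have c: "(8 :: nat) choose 2 = 28" "(12 :: nat) choose 2 = 66" "(7 :: nat) choose 2 = 21"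
      by (simp_all add: choose_two)
    have U7: "card U = 7" "\<And>w. w \<in> U \<Longrightarrow> vdegree H w \<le> 7" using U balanced by auto
    have out: "y \<in> verts H - U" if "x \<in> U" "{x, y} \<in> edges H" for x y
      using low_half_independent[OF H closed, of 7 U x y] U(1) U7 that cVH mH m balanced c by simp
    have "finite U" using finite_subset[OF U(1)] finV VH by simp
    then have W7: "card (verts H - U) = 7"
      using U(1) U7(1) cVH balanced by (simp add: card_Diff_subset)
    \<comment> \<open>The seven vertices of \<open>U\<close> serve as the six isolated vertices and the one-vertex clique of
      \<open>S_graph 14 7\<close>; any choice of the six works.\<close>
    obtain I where I: "I \<subseteq> U" "card I = 6" using obtain_subset_with_card_n[of 6 U] U7(1) by auto
    have sets: "verts H - U \<subseteq> verts G" "I \<subseteq> verts G" "(verts H - U) \<inter> I = {}" "card I = 7 - 1"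
      using I U(1) VH by auto
    have nbG: "\<And>x y. x \<in> I \<Longrightarrow> {x, y} \<in> edges G \<Longrightarrow> y \<in> verts H - U" using out I(1) sub by blast
    have n7: "1 \<le> (7 :: nat)" "2 * 7 \<le> n" using balanced by simp_all
    note S_part[OF n7 sets(1) W7 sets(2,4,3) nbG]
    moreover have "card (edges (S_graph 14 7)) = 70" using card_edges_S_graph[of 7 14] c by simp
    ultimately have "\<exists>i\<in>{0..1}. G \<in> S_family 14 7 i"
      using m mG c balanced by (intro bexI[of _ "70 - card (edges G)"]) simp_all
    then show False using assms(8) balanced by blast
  qed
qed

end
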